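(* Let $G=(V,E)$ be an undirected hypergraph with $E\neq\emptyset$, and let $x\in E$ be the hyperedge to be eliminated. Write $E=E_x\cup E_{\not x}$, where $$E_x=\{e\in E \mid e\cap x\neq\emptyset\},\qquad E_{\not x}=\{e\in E\mid e\cap x=\emptyset\}.$$ Then the hypergraph after elimination of $x$ (as defined in the context) is $\widetilde G=(\widetilde V,\widetilde E)$ with $\widetilde V=V$ and $$\widetilde E=\{e\cup x \mid e\in E_x\setminus\{x\}\}\cup E_{\not x}.$$
   Context: An undirected hypergraph $G=(V,E)$ consists of a finite vertex set $V=\{1,\dots,n\}$ and a set $E$ of hyperedges, each a nonempty subset of $V$. Each hyperedge $e\in E$ represents the nonzero pattern (set of positions of nonzero entries) of a vector $z_e\in\mathbb{C}^n$ in a representation "real diagonal matrix plus $\sum_{e\in E} r_e z_e z_e^H$". Numerically, eliminating $x$ means computing an eigendecomposition $D+r_x z_x z_x^H=QD'Q^H$ with $D$ diagonal, where $Q$ coincides with the identity outside the rows and columns indexed by $x$, and replacing each remaining vector $z_e$ by $Q^Hz_e$. Symbolic convention (no accidental cancellation): the nonzero pattern of $Q^H$ is taken to be the $0/1$ matrix $S^{x}\in\{0,1\}^{n\times n}$ with $S^x_{ij}=1$ if and only if $i=j$ or both $i\in x$ and $j\in x$. The pattern of $Q^Hz_e$ is taken to be $\{i\in V\mid \exists j\in e:\ S^x_{ij}=1\}$. The hypergraph after elimination of $x$ is, by definition, the hypergraph with vertex set $V$ whose hyperedges are the sets $\{i\in V\mid \exists j\in e:\ S^x_{ij}=1\}$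 for $e\in E\setminus\{x\}$. *)

theory Defs
  imports Main
begin

record hypergraph =
  verts :: "nat set"
  hyperedges :: "nat set set"

definition is_hypergraph :: "nat \<Rightarrow> hypergraph \<Rightarrow> bool" where
  "is_hypergraph n G \<longleftrightarrow>
     verts G = {1..n} \<and> (\<forall>e \<in> hyperedges G. e \<subseteq> verts G \<and> e \<noteq> {})"

text \<open>
  The symbolic (no accidental cancellation) nonzero pattern of \<open>Q\<^sup>H\<close>, where
  \<open>D + r z z\<^sup>H = Q D' Q\<^sup>H\<close> is the eigendecomposition computed when eliminating the
  hyperedge \<open>x\<close>. The function represents an \<open>n \<times> n\<close> matrix; only its entries with
  both indices in \<open>{1..n}\<close> are meant.
\<close>
definition elim_pattern :: "nat set \<Rightarrow> nat \<Rightarrow> nat \<Rightarrow> nat" where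
  "elim_pattern x i j = (if i = j \<or> (i \<in> x \<and> j \<in> x) then 1 else 0)"

text \<open>
  The symbolic pattern of a matrix-vector product, for a matrix with \<open>0/1\<close> pattern
  \<open>S\<close> (rows indexed by \<open>V\<close>) and a vector with nonzero positions \<open>e\<close>.
\<close>
definition mult_pattern :: "nat set \<Rightarrow> (nat \<Rightarrow> nat \<Rightarrow> nat) \<Rightarrow> nat set \<Rightarrow> nat set" where
  "mult_pattern V S e = {i \<in> V. \<exists>j \<in> e. S i j = 1}"

definition eliminate :: "hypergraph \<Rightarrow> nat set \<Rightarrow> hypergraph" where
  "eliminate G x =
     \<lparr> verts = verts G,
       hyperedges = {mult_pattern (verts G) (elim_pattern x) e | e. e \<in> hyperedges G - {x}} \<rparr>"

lemma is_hypergraph_eliminate: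
  assumes "is_hypergraph n G"
  shows "is_hypergraph n (eliminate G x)"
proof -
  have "mult_pattern (verts G) (elim_pattern x) e \<noteq> {}"
    if e: "e \<in> hyperedges G" for e
  proof -
    obtain i where "i \<in> e" "i \<in> verts G"
      using assms e unfolding is_hypergraph_def by blast
    then have "i \<in> mult_pattern (verts G) (elim_pattern x) e"
      by (auto simp: mult_pattern_def elim_pattern_def intro!: bexI[of _ i])
    then show ?thesis by blast
  qed
  moreover have "mult_pattern (verts G) (elim_pattern x) e \<subseteq> verts G" for e
    by (auto simp: mult_pattern_def)
  ultimately show ?thesis
    using assms unfolding is_hypergraph_def eliminate_def by auto
qed

end

theory Submission
  imports Defs
begin

text \<open>The pattern of \<open>Q^H\<close> is the identity plus a full block on \<open>x\<close>.
  Row \<open>i\<close> therefore hits \<open>e\<close> exactly when \<open>i\<close> is in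
  \<open>e\<close>, or \<open>i\<close> is in \<open>x\<close> and \<open>e\<close> meets
  \<open>x\<close>. So a hyperedge disjoint from \<open>x\<close> is unchanged, while one meeting
  \<open>x\<close> absorbs all of it; as both sets lie in \<open>V\<close>, restricting rows to
  \<open>V\<close> loses nothing. This is \<open>mult_elim_pattern\<close>; the theorem applies it
  separately to the two classes of hyperedges.\<close>

lemma mult_elim_pattern:
  assumes "e \<subseteq> V" and "x \<subseteq> V"
  shows "mult_pattern V (elim_pattern x) e = (if e \<inter> x = {} then e else e \<union> x)"
  using assms by (auto simp: mult_pattern_def elim_pattern_def split: if_splits)

theorem theorem4p5:
  fixes n :: nat and V x :: "nat set" and E E\<^sub>x E\<^sub>n\<^sub>x :: "nat set set"
  assumes "is_hypergraph n \<lparr> verts = V, hyperedges = E \<rparr>"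
    and "E \<noteq> {}"
    and "x \<in> E"
    and "E\<^sub>x = {e \<in> E. e \<inter> x \<noteq> {}}"
    and "E\<^sub>n\<^sub>x = {e \<in> E. e \<inter> x = {}}"
  shows "E = E\<^sub>x \<union> E\<^sub>n\<^sub>x \<and>
    eliminate \<lparr> verts = V, hyperedges = E \<rparr> x =
      \<lparr> verts = V, hyperedges = {e \<union> x | e. e \<in> E\<^sub>x - {x}} \<union> E\<^sub>n\<^sub>x \<rparr>"
proof -
  have sub: "e \<subseteq> V" if "e \<in> E" for e
    using assms(1) that by (auto simp: is_hypergraph_def)
  \<comment> \<open>Being nonempty, \<open>x\<close> meets itself, so it belongs to
    \<open>E\<^sub>x\<close> and deleting it leaves \<open>E\<^sub>n\<^sub>x\<close> intact.\<close>
  have "x \<noteq> {}"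
    using assms(1,3) by (auto simp: is_hypergraph_def)
  then have "x \<notin> E\<^sub>n\<^sub>x"
    using assms(5) by simp
  have split: "E = E\<^sub>x \<union> E\<^sub>n\<^sub>x"
    using assms(4,5) by blast
  let ?f = "mult_pattern V (elim_pattern x)"
  have f: "?f e = (if e \<inter> x = {} then e else e \<union> x)" if "e \<in> E" for e
    using mult_elim_pattern sub that assms(3) by blast
  \<comment> \<open>On each of the two images only one branch of the case distinction in
    \<open>f\<close> survives: union with \<open>x\<close> on the first, the identity on the
    second.\<close>
  have "{?f e | e. e \<in> E - {x}} = ?f ` (E\<^sub>x - {x}) \<union> ?f ` E\<^sub>n\<^sub>x"
    using split \<open>x \<notin> E\<^sub>n\<^sub>x\<close> by blast
  also have "?f ` (E\<^sub>x - {x}) = (\<lambda>e. e \<union> x) ` (E\<^sub>x - {x})"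
    using assms(4) by (intro image_cong) (auto simp: f)
  also have "?f ` E\<^sub>n\<^sub>x = (\<lambda>e. e) ` E\<^sub>n\<^sub>x"
    using assms(5) by (intro image_cong) (auto simp: f)
  finally have "{?f e | e. e \<in> E - {x}} = {e \<union> x | e. e \<in> E\<^sub>x - {x}} \<union> E\<^sub>n\<^sub>x"
    by (simp only: Setcompr_eq_image image_ident)
  with split show ?thesis
    by (simp add: eliminate_def)
qed

end
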